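(* Let $a$ be an integer and let $n$ be a positive odd integer. Then, for an indeterminate $q$ (equivalently, for every complex number $q\neq 0,1$), $$\det\left[\left[\left\lfloor\frac{aj-(a+1)k}{n}\right\rfloor\right]_q\right]_{1\leqslant j,k\leqslant n}=-\left(\frac{a(a+1)}{n}\right)q^{(1-3n)/2}.$$
   Context: For an integer $m$, its $q$-analogue is $[m]_q=(1-q^m)/(1-q)$ (so $[m]_q=-q^m(1-q^{-m})/(1-q)$ for negative $m$). $\lfloor x\rfloor$ denotes the largest integer not exceeding $x$. $\left(\frac{\cdot}{n}\right)$ denotes the Jacobi symbol modulo the positive odd integer $n$ (equal to $0$ when the argument is not coprime to $n$, and $\left(\frac{\cdot}{1}\right)=1$). *)

theory Defs
  imports Complex_Main "HOL-Number_Theory.Number_Theory" "Jordan_Normal_Form.Determinant"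
begin

definition qint :: "complex \<Rightarrow> int \<Rightarrow> complex" where
  "qint q m = (1 - q powi m) / (1 - q)"

definition Jacobi :: "int \<Rightarrow> nat \<Rightarrow> int" where
  "Jacobi a n = (\<Prod>p\<in>prime_factors n. Legendre a (int p) ^ multiplicity p n)"

end

theory Submission
  imports Defs "HOL-Combinatorics.Cycles"
begin

text \<open>
  Put \<open>b = a + 1\<close>. Splitting \<open>a j\<close> and \<open>b k\<close> into quotients \<open>A\<^sub>j\<close>, \<open>B\<^sub>k\<close> and remainders
  \<open>\<sigma> j\<close>, \<open>\<tau> k\<close> modulo \<open>n\<close>, the matrix is \<open>(J - X) / (1 - q)\<close>, where \<open>J\<close> is the all-ones
  matrix and \<open>X\<^sub>j\<^sub>k = q\<^bsup>A\<^sub>j - B\<^sub>k\<^esup> T(\<sigma> j, \<tau> k)\<close> with \<open>T(x, y) = 1\<close> for \<open>y \<le> x\<close> and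
  \<open>1 / q\<close> otherwise. If \<open>a\<close> or \<open>b\<close> is not coprime to \<open>n\<close>, then \<open>X\<close> has three proportional rows
  or columns, and both sides vanish.

  Otherwise \<open>\<sigma>\<close> and \<open>\<tau>\<close> are permutations whose signs are Jacobi symbols by Zolotarev's lemma,
  which gives \<open>det X\<close>. The rank-one update \<open>J\<close> contributes the factor \<open>1 - \<Sum>\<^sub>k w\<^sub>k\<close>, where
  \<open>X w\<close> is the all-ones vector. Explicitly,
  \<open>w\<^sub>k = (v(b k) - v(b k - 1)) / (1 - 1 / q)\<close> with \<open>v(a j - n A) = q\<^bsup>-A\<^esup>\<close> for \<open>1 \<le> j \<le> n\<close>,
  and since \<open>b k - 1 = b (k - 1) + a\<close> the sum telescopes to \<open>q\<close>.

  Zolotarev's lemma is proved for affine maps \<open>x \<mapsto> a x + c\<close> modulo \<open>n\<close>: writing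
  \<open>x = r + m t\<close> with \<open>0 \<le> r < m\<close>, such a map modulo \<open>m p\<close> becomes a skew product of affine maps
  modulo \<open>m\<close> and modulo \<open>p\<close>.
\<close>

section \<open>Signs of affine permutations\<close>

definition fiber_perm :: "'a set \<Rightarrow> ('a \<Rightarrow> 'b \<Rightarrow> 'b) \<Rightarrow> 'a \<times> 'b \<Rightarrow> 'a \<times> 'b" where
  "fiber_perm I g = (\<lambda>(i, t). if i \<in> I then (i, g i t) else (i, t))"

lemma fiber_perm_permutes:
  assumes "\<And>i. i \<in> I \<Longrightarrow> g i permutes T"
  shows "fiber_perm I g permutes (I \<times> T)"
proof (rule bij_imp_permutes)
  have in_T: "g i t \<in> T \<longleftrightarrow> t \<in> T" if "i \<in> I" for i t
    using assms[OF that] by (simp add: permutes_in_image)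
  show "bij_betw (fiber_perm I g) (I \<times> T) (I \<times> T)"
  proof (rule bij_betwI[where g = "fiber_perm I (\<lambda>i. Hilbert_Choice.inv (g i))"])
    show "fiber_perm I (\<lambda>i. Hilbert_Choice.inv (g i)) \<in> I \<times> T \<rightarrow> I \<times> T"
      using assms by (auto simp: fiber_perm_def permutes_in_image[OF permutes_inv])
  qed (use assms in_T in \<open>auto simp: fiber_perm_def permutes_inverses[OF assms]\<close>)
  show "fiber_perm I g x = x" if "x \<notin> I \<times> T" for x
    using that permutes_not_in[OF assms] by (auto simp: fiber_perm_def split: prod.splits)
qed

text \<open>Induction on \<open>I\<close> peels off one fibre at a time:
  \<open>map_permutation T (Pair i) (g i)\<close> is \<open>g i\<close> transported to
  \<open>{i} \<times> T\<close>, and transport along an injection preserves the sign.\<close>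

lemma sign_fiber_perm:
  assumes "finite I" "finite T" "\<And>i. i \<in> I \<Longrightarrow> g i permutes T"
  shows "sign (fiber_perm I g) = (\<Prod>i\<in>I. sign (g i))"
  using assms(1,3)
proof (induction I rule: finite_induct)
  case empty
  have "fiber_perm {} g = id" by (auto simp: fiber_perm_def)
  thus ?case by simp
next
  case (insert i I)
  have g: "g i permutes T" using insert.prems by simp
  have "fiber_perm (insert i I) g = map_permutation T (Pair i) (g i) \<circ> fiber_perm I g"
  proof (rule ext, clarify)
    fix j t
    have *: "map_permutation T (Pair i) (g i) (j, t) = (if j = i then (i, g i t) else (j, t))" for j t
    proof (cases "j = i \<and> t \<in> T")
      case True
      thus ?thesis by (simp add: map_permutation_apply inj_on_def)
    next
      case False
      thus ?thesis using permutes_not_in[OF g]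
        by (auto simp: map_permutation_def restrict_id_def)
    qed
    show "fiber_perm (insert i I) g (j, t)
        = (map_permutation T (Pair i) (g i) \<circ> fiber_perm I g) (j, t)"
      using insert.hyps by (auto simp: fiber_perm_def *)
  qed
  moreover have "map_permutation T (Pair i) (g i) permutes ({i} \<times> T)"
    by (rule map_permutation_permutes[OF _ g]) (auto simp: bij_betw_def inj_on_def)
  moreover have "fiber_perm I g permutes (I \<times> T)"
    by (rule fiber_perm_permutes) (use insert.prems in auto)
  moreover have "sign (map_permutation T (Pair i) (g i)) = sign (g i)"
    by (rule sign_map_permutation) (use g assms in \<open>auto simp: inj_on_def\<close>)
  ultimately show ?case
    using insert assms(2) sign_compose[of "map_permutation T (Pair i) (g i)" "fiber_perm I g"]
      permutes_imp_permutation[of "{i} \<times> T"] permutes_imp_permutation[of "I \<times> T"]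
    by (simp del: o_apply comp_apply)
qed

text \<open>\<open>h\<close> is the fibrewise action of the \<open>g i\<close> followed by
  \<open>F\<close>, which applies \<open>f\<close> in each of the \<open>card T\<close> copies of
  \<open>I\<close>.\<close>

lemma sign_skew_product:
  assumes "finite I" "finite T" and f: "f permutes I" and g: "\<And>i. i \<in> I \<Longrightarrow> g i permutes T"
    and h: "\<And>i t. h (i, t) = (if i \<in> I \<and> t \<in> T then (f i, g i t) else (i, t))"
  shows "h permutes (I \<times> T)" and "sign h = sign f ^ card T * (\<Prod>i\<in>I. sign (g i))"
proof -
  \<comment> \<open>\<open>fiber_perm\<close> moves only the second coordinate, so the action of
    \<open>f\<close> on the first one is obtained by swapping coordinates.\<close>
  define F where "F = map_permutation (T \<times> I) prod.swap (fiber_perm T (\<lambda>_. f))"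
  have perm: "fiber_perm T (\<lambda>_. f) permutes (T \<times> I)"
    by (rule fiber_perm_permutes) (rule f)
  have F: "F permutes (I \<times> T)"
    unfolding F_def by (rule map_permutation_permutes[OF _ perm])
      (auto simp: bij_betw_def inj_on_def)
  have "sign F = sign (fiber_perm T (\<lambda>_. f))"
    unfolding F_def by (rule sign_map_permutation) (use perm assms in \<open>auto simp: inj_on_def\<close>)
  also have "\<dots> = sign f ^ card T"
    using sign_fiber_perm[of T I "\<lambda>_. f"] assms by simp
  finally have sF: "sign F = sign f ^ card T" .
  have G: "fiber_perm I g permutes (I \<times> T)"
    by (rule fiber_perm_permutes) (rule g)
  have Fap: "F (i, t) = (f i, t)" if "i \<in> I" "t \<in> T" for i t
  proof -
    have "F (prod.swap (t, i)) = prod.swap (fiber_perm T (\<lambda>_. f) (t, i))"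
      unfolding F_def by (rule map_permutation_apply) (use that in \<open>auto simp: inj_on_def\<close>)
    thus ?thesis using that by (simp add: fiber_perm_def)
  qed
  have hFG: "h = F \<circ> fiber_perm I g"
  proof (rule ext, clarify)
    fix i t
    show "h (i, t) = (F \<circ> fiber_perm I g) (i, t)"
    proof (cases "i \<in> I \<and> t \<in> T")
      case True
      hence "g i t \<in> T" using g by (simp add: permutes_in_image)
      thus ?thesis using True by (simp add: h Fap fiber_perm_def)
    next
      case False
      hence "(i, t) \<notin> I \<times> T" by simp
      thus ?thesis using False permutes_not_in[OF F] permutes_not_in[OF G] by (simp only: h) simp
    qed
  qed
  show "h permutes (I \<times> T)"
    unfolding hFG by (rule permutes_compose[OF G F])
  show "sign h = sign f ^ card T * (\<Prod>i\<in>I. sign (g i))"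
    unfolding hFG using F G assms
    by (simp add: sign_compose permutes_imp_permutation[of "I \<times> T"] sF sign_fiber_perm)
qed

lemma sign_cycle_of_list:
  "distinct cs \<Longrightarrow> sign (cycle_of_list cs) = (-1) ^ (length cs - 1)"
  by (induction cs rule: cycle_of_list.induct)
     (auto simp: sign_compose permutation_of_cycle permutation_swap_id sign_swap_id)

lemma cycle_of_list_nth:
  assumes "distinct cs" "i < length cs"
  shows "cycle_of_list cs (cs ! i) = cs ! (Suc i mod length cs)"
proof -
  have "map ((cycle_of_list cs) ^^ 1) cs = rotate 1 cs"
    by (rule cyclic_rotation) (use assms in auto)
  hence "map (cycle_of_list cs) cs ! i = rotate1 cs ! i" by simp
  thus ?thesis using assms by (simp add: nth_rotate1)
qed

lemma odd_prime_gt_2_nat: "prime p \<Longrightarrow> odd p \<Longrightarrow> p > (2 :: nat)"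
  by (metis dvd_refl prime_ge_2_nat le_neq_implies_less)

section \<open>Affine maps modulo \<open>n\<close> as permutations\<close>

text \<open>Fixing all \<open>x \<ge> n\<close> turns an invertible residue map into a permutation
  of the naturals, to which \<open>sign\<close> applies. The offset \<open>c\<close> is kept because
  carries produce offsets when the modulus is split.\<close>

definition affine_perm :: "int \<Rightarrow> int \<Rightarrow> nat \<Rightarrow> nat \<Rightarrow> nat" where
  "affine_perm a c n x = (if x < n then nat ((a * int x + c) mod int n) else x)"

lemma affine_perm_less: "x < n \<Longrightarrow> affine_perm a c n x < n"
  by (simp add: affine_perm_def nat_less_iff)

lemma int_affine_perm: "x < n \<Longrightarrow> int (affine_perm a c n x) = (a * int x + c) mod int n"
  by (simp add: affine_perm_def)

lemma affine_perm_permutes: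
  assumes "coprime a (int n)"
  shows "affine_perm a c n permutes {0..<n}"
proof (rule bij_imp_permutes)
  have inj: "inj_on (affine_perm a c n) {0..<n}"
  proof (rule inj_onI)
    fix x y assume xy: "x \<in> {0..<n}" "y \<in> {0..<n}" "affine_perm a c n x = affine_perm a c n y"
    hence "[a * int x + c = a * int y + c] (mod int n)"
      by (metis atLeastLessThan_iff cong_def int_affine_perm)
    hence "[a * int x = a * int y] (mod int n)"
      by (simp add: cong_add_rcancel)
    hence "[int x = int y] (mod int n)"
      using assms by (simp add: cong_mult_lcancel)
    thus "x = y" using xy by (simp add: cong_int_iff cong_less_modulus_unique_nat)
  qed
  moreover have "affine_perm a c n ` {0..<n} \<subseteq> {0..<n}"
    by (auto simp: affine_perm_less)
  ultimately show "bij_betw (affine_perm a c n) {0..<n} {0..<n}"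
    by (simp add: bij_betw_def endo_inj_surj)
qed (simp add: affine_perm_def)

lemma permutation_affine_perm: "coprime a (int n) \<Longrightarrow> permutation (affine_perm a c n)"
  by (rule permutes_imp_permutation[OF _ affine_perm_permutes]) simp_all

lemma affine_perm_cong:
  assumes "[a = b] (mod int n)" "[c = d] (mod int n)"
  shows "affine_perm a c n = affine_perm b d n"
proof
  fix x
  have "[a * int x + c = b * int x + d] (mod int n)"
    using assms by (intro cong_add cong_mult) simp_all
  thus "affine_perm a c n x = affine_perm b d n x"
    by (simp add: affine_perm_def cong_def)
qed

lemma affine_perm_comp:
  "affine_perm a c n \<circ> affine_perm b d n = affine_perm (a * b) (a * d + c) n"
proof
  fix x
  show "(affine_perm a c n \<circ> affine_perm b d n) x = affine_perm (a * b) (a * d + c) n x"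
  proof (cases "x < n")
    case True
    have "int (affine_perm a c n (affine_perm b d n x))
        = (a * ((b * int x + d) mod int n) + c) mod int n"
      using True by (simp add: int_affine_perm affine_perm_less)
    also have "\<dots> = (a * (b * int x + d) + c) mod int n"
      by (metis mod_add_left_eq mod_mult_right_eq)
    also have "\<dots> = int (affine_perm (a * b) (a * d + c) n x)"
      using True by (simp add: int_affine_perm algebra_simps)
    finally show ?thesis by simp
  qed (simp add: affine_perm_def)
qed

lemma sign_affine_perm_mult:
  assumes "coprime a (int n)" "coprime b (int n)"
  shows "sign (affine_perm (a * b) (a * d + c) n)
    = sign (affine_perm a c n) * sign (affine_perm b d n)"
  unfolding affine_perm_comp[symmetric]
  by (rule sign_compose) (use assms in \<open>auto intro: permutation_affine_perm\<close>)

lemma affine_perm_1_0: "affine_perm 1 0 n = id"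
  by (auto simp: affine_perm_def fun_eq_iff)

text \<open>The \<open>n\<close>-th iterate of a translation is the identity, so the
  \<open>n\<close>-th power of its sign is 1, and \<open>n\<close> is odd.\<close>

lemma sign_affine_perm_translation:
  assumes "odd n"
  shows "sign (affine_perm 1 c n) = 1"
proof -
  have "sign (affine_perm 1 (int k * c) n) = sign (affine_perm 1 c n) ^ k" for k
  proof (induction k)
    case (Suc k)
    show ?case
      using Suc sign_affine_perm_mult[of 1 n 1 "int k * c" c] by (simp add: algebra_simps)
  qed (simp add: affine_perm_1_0)
  from this[of n] have "sign (affine_perm 1 c n) ^ n = sign (affine_perm 1 0 n)"
    using affine_perm_cong[of 1 1 n "int n * c" 0] by (simp add: cong_def)
  thus ?thesis
    using assms by (cases "affine_perm 1 c n" rule: sign_cases) (auto simp: affine_perm_1_0)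
qed

lemma sign_affine_perm_power:
  assumes "coprime a (int n)"
  shows "sign (affine_perm (a ^ k) 0 n) = sign (affine_perm a 0 n) ^ k"
proof (induction k)
  case (Suc k)
  thus ?case using assms sign_affine_perm_mult[of a n "a ^ k" 0 0] by simp
qed (simp add: affine_perm_1_0)

text \<open>Multiplication by a primitive root modulo \<open>p\<close> is a cycle of even length \<open>p - 1\<close>.\<close>

lemma sign_affine_perm_primroot:
  assumes p: "prime p" "odd p" and g: "residue_primroot p g"
  shows "sign (affine_perm (int g) 0 p) = -1"
proof -
  have p2: "p > 2" by (rule odd_prime_gt_2_nat) (use p in auto)
  have gen: "bij_betw (\<lambda>i. g ^ i mod p) {..<p - 1} {0<..<p}"
    using residue_primroot_is_generator[OF _ g] p p2
    by (simp add: totient_prime totatives_prime)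
  \<comment> \<open>The orbit of 1 under multiplication by \<open>g\<close>, in order, so that the
    map is the cyclic shift of this list.\<close>
  define cs where "cs = map (\<lambda>i. g ^ i mod p) [0..<p - 1]"
  have len: "length cs = p - 1" by (simp add: cs_def)
  have dist: "distinct cs"
    using gen by (simp add: cs_def distinct_map bij_betw_def atLeast0LessThan)
  have set: "set cs = {0<..<p}"
    using gen by (simp add: cs_def bij_betw_def atLeast0LessThan)
  have per: "g ^ (p - 1) mod p = 1"
    using g p p2 by (metis cong_def euler_theorem residue_primroot_def coprime_commute
        mod_less totient_prime less_trans one_less_numeral_iff semiring_norm(76))
  \<comment> \<open>This handles the wrap-around from the last entry of \<open>cs\<close> to the
    first.\<close>
  have pow: "g ^ (i mod (p - 1)) mod p = g ^ i mod p" for i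
  proof -
    have "g ^ i = (g ^ (p - 1)) ^ (i div (p - 1)) * g ^ (i mod (p - 1))"
      by (simp flip: power_mult power_add)
    also have "\<dots> mod p = (g ^ (p - 1) mod p) ^ (i div (p - 1)) * g ^ (i mod (p - 1)) mod p"
      by (metis mod_mult_left_eq power_mod)
    finally show ?thesis unfolding per by simp
  qed
  have "affine_perm (int g) 0 p = cycle_of_list cs"
  proof
    fix x
    have mult: "affine_perm (int g) 0 p x = (if x < p then g * x mod p else x)"
      by (simp add: affine_perm_def flip: of_nat_mult of_nat_mod)
    show "affine_perm (int g) 0 p x = cycle_of_list cs x"
    proof (cases "x \<in> set cs")
      case True
      then obtain i where i: "i < p - 1" "x = cs ! i"
        by (metis in_set_conv_nth len)
      hence x: "x = g ^ i mod p" by (simp add: cs_def)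
      have "Suc i mod (p - 1) < p - 1" using i by simp
      hence "cycle_of_list cs x = g ^ (Suc i mod (p - 1)) mod p"
        using cycle_of_list_nth[OF dist, of i] i len by (simp add: cs_def)
      also have "\<dots> = g * x mod p"
        unfolding pow x by (simp add: mod_simps)
      finally show ?thesis using True set by (simp add: mult)
    next
      case False
      hence "x = 0 \<or> x \<ge> p" using set by auto
      thus ?thesis using id_outside_supp[OF False] by (auto simp: mult)
    qed
  qed
  moreover have "odd (length cs - 1)" using len p p2 by simp
  ultimately show ?thesis using dist by (simp add: sign_cycle_of_list)
qed

section \<open>Legendre symbols via Euler's criterion\<close>

lemma Legendre_values: "Legendre a p \<in> {-1, 0, 1}"
  by (simp add: Legendre_def)

lemma Legendre_cong_power:
  assumes "prime p" "odd p"
  shows "[Legendre a (int p) = a ^ ((p - 1) div 2)] (mod int p)"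
proof -
  have p2: "p > 2" by (rule odd_prime_gt_2_nat) (use assms in auto)
  have "(int p - 1) div 2 = int ((p - 1) div 2)" using p2 by (simp add: of_nat_diff zdiv_int)
  thus ?thesis
    using euler_criterion[of p a] assms p2 by simp
qed

text \<open>Two elements of \<open>{-1, 0, 1}\<close> differ by at most 2, which is less than
  \<open>p\<close>, so a congruence modulo \<open>p\<close> between them is an equality.\<close>

lemma Legendre_eqI:
  assumes "prime p" "odd p" "e \<in> {-1, 0, 1}" "[a ^ ((p - 1) div 2) = e] (mod int p)"
  shows "Legendre a (int p) = e"
proof -
  have p2: "p > 2" by (rule odd_prime_gt_2_nat) (use assms in auto)
  have "[Legendre a (int p) = e] (mod int p)"
    using cong_trans[OF Legendre_cong_power assms(4)] assms by simp
  hence "int p dvd Legendre a (int p) - e"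
    by (simp add: cong_iff_dvd_diff)
  moreover have "\<bar>Legendre a (int p) - e\<bar> < int p"
    using Legendre_values[of a "int p"] assms(3) p2 by auto
  ultimately show ?thesis
    using dvd_imp_le_int[of "Legendre a (int p) - e" "int p"] by fastforce
qed

text \<open>The power is a square root of 1 modulo a prime, and it is not 1 because \<open>g\<close>
  has order \<open>p - 1\<close>.\<close>

lemma primroot_half_power:
  assumes "prime p" "odd p" "residue_primroot p g"
  shows "[int g ^ ((p - 1) div 2) = -1] (mod int p)"
proof -
  have p2: "p > 2" by (rule odd_prime_gt_2_nat) (use assms in auto)
  define h where "h = (p - 1) div 2"
  have h: "2 * h = p - 1" "0 < h" "h < p - 1" using assms p2 by (auto simp: h_def)
  have ord_g: "ord p g = p - 1" "coprime p g"
    using assms p2 by (auto simp: residue_primroot_def totient_prime)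
  have "[g ^ (p - 1) = 1] (mod p)" using ord_g ord[of g p] by simp
  hence "[int g ^ (2 * h) = 1] (mod int p)"
    using h by (metis cong_int_iff of_nat_1 of_nat_power)
  hence "int p dvd (int g ^ h - 1) * (int g ^ h + 1)"
    by (simp add: cong_iff_dvd_diff algebra_simps mult_2_right power_add)
  hence "int p dvd int g ^ h - 1 \<or> int p dvd int g ^ h + 1"
    using assms by (simp add: prime_dvd_mult_iff)
  moreover have "\<not> int p dvd int g ^ h - 1"
  proof
    assume "int p dvd int g ^ h - 1"
    hence "[int (g ^ h) = int 1] (mod int p)" by (simp add: cong_iff_dvd_diff)
    hence "[g ^ h = 1] (mod p)" by (simp only: cong_int_iff)
    hence "p - 1 dvd h" using ord_g(1) ord_divides[of g h p] by (simp only:)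
    thus False using h by (simp add: nat_dvd_not_less)
  qed
  ultimately show ?thesis by (simp add: cong_iff_dvd_diff h_def)
qed

text \<open>Zolotarev's lemma: with \<open>a\<close> congruent to \<open>g ^ k\<close> for a
  primitive root \<open>g\<close>, both sides equal \<open>(-1) ^ k\<close>.\<close>

lemma sign_affine_perm_prime:
  assumes p: "prime p" "odd p" and a: "coprime a (int p)"
  shows "sign (affine_perm a c p) = Legendre a (int p)"
proof -
  have p2: "p > 2" by (rule odd_prime_gt_2_nat) (use p in auto)
  obtain g where g: "residue_primroot p g"
    using prime_primitive_root_exists[of p] p p2 by auto
  hence cop: "coprime (int g) (int p)"
    by (simp add: residue_primroot_def coprime_commute)
  have "nat (a mod int p) \<in> {0<..<p}"
  proof -
    have "\<not> int p dvd a" using a p2 coprime_common_divisor[of a "int p" "int p"] by auto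
    hence "a mod int p \<noteq> 0" by (simp add: dvd_eq_mod_eq_0)
    moreover have "a mod int p \<ge> 0" "a mod int p < int p" using p2 by simp_all
    ultimately show ?thesis by (simp add: nat_less_iff)
  qed
  hence "nat (a mod int p) \<in> (\<lambda>i. g ^ i mod p) ` {..<p - 1}"
    using residue_primroot_is_generator[OF _ g] p p2
    by (simp add: totient_prime totatives_prime bij_betw_def)
  then obtain k where "nat (a mod int p) = g ^ k mod p" by blast
  hence "a mod int p = int (g ^ k) mod int p"
    using p2 by (metis of_nat_0_less_iff of_nat_mod pos_mod_sign int_nat_eq less_trans zero_less_numeral)
  hence k: "[a = int g ^ k] (mod int p)" by (simp add: cong_def)
  \<comment> \<open>The map is multiplication by \<open>g ^ k\<close> followed by translation by
    \<open>c\<close>, which is even.\<close>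
  have "sign (affine_perm a c p) = sign (affine_perm 1 c p) * sign (affine_perm (int g ^ k) 0 p)"
    using cop affine_perm_cong[OF k, of c c] sign_affine_perm_mult[of 1 p "int g ^ k" 0 c] by simp
  also have "\<dots> = (-1) ^ k"
    using p g cop by (simp add: sign_affine_perm_translation sign_affine_perm_power
        sign_affine_perm_primroot)
  also have "Legendre a (int p) = (-1) ^ k"
  proof (rule Legendre_eqI[OF p])
    have "[a ^ ((p - 1) div 2) = (int g ^ k) ^ ((p - 1) div 2)] (mod int p)"
      by (rule cong_pow[OF k])
    also have "(int g ^ k) ^ ((p - 1) div 2) = (int g ^ ((p - 1) div 2)) ^ k"
      by (simp add: mult.commute flip: power_mult)
    also have "[\<dots> = (-1) ^ k] (mod int p)"
      by (rule cong_pow[OF primroot_half_power[OF p g]])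
    finally show "[a ^ ((p - 1) div 2) = (-1) ^ k] (mod int p)" .
  qed (cases "even k"; simp)
  finally show ?thesis by simp
qed

section \<open>The Jacobi symbol as a product over prime factors\<close>

lemma Jacobi_1: "Jacobi a 1 = 1"
  by (simp add: Jacobi_def)

lemma Jacobi_eq_prod_mset: "Jacobi a n = (\<Prod>p\<in>#prime_factorization n. Legendre a (int p))"
  unfolding Jacobi_def image_prod_mset_multiplicity
  by (intro prod.cong) (auto simp: count_prime_factorization)

lemma Jacobi_mult_prime:
  assumes "prime p" "m > 0"
  shows "Jacobi a (m * p) = Jacobi a m * Legendre a (int p)"
  using assms by (simp add: Jacobi_eq_prod_mset prime_factorization_mult prime_factorization_prime)

text \<open>A common prime factor of \<open>a\<close> and \<open>n\<close> contributes a vanishing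
  Legendre factor.\<close>

lemma Jacobi_eq_0:
  assumes "n > 0" "\<not> coprime a (int n)"
  shows "Jacobi a n = 0"
proof -
  have "nat (gcd a (int n)) \<noteq> 1" using assms by (simp add: coprime_iff_gcd_eq_1 nat_eq_iff)
  then obtain p where p: "prime p" "p dvd nat (gcd a (int n))" using prime_factor_nat by blast
  have "int p dvd gcd a (int n)" using p by (metis gcd_ge_0_int int_dvd_int_iff nat_0_le)
  hence dvd: "int p dvd a" "p dvd n" by auto
  have "Legendre a (int p) = 0" using dvd by (simp add: Legendre_def cong_0_iff)
  thus ?thesis
    unfolding Jacobi_eq_prod_mset using p dvd assms
    by (auto simp: prod_mset_zero_iff in_prime_factors_iff image_iff)
qed

lemma Legendre_mult:
  assumes "prime p" "odd p"
  shows "Legendre (a * b) (int p) = Legendre a (int p) * Legendre b (int p)"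
proof (rule Legendre_eqI[OF assms])
  from cong_mult[OF Legendre_cong_power[OF assms] Legendre_cong_power[OF assms], of a b]
  show "[(a * b) ^ ((p - 1) div 2) = Legendre a (int p) * Legendre b (int p)] (mod int p)"
    by (simp add: power_mult_distrib cong_sym)
  show "Legendre a (int p) * Legendre b (int p) \<in> {-1, 0, 1}"
    using Legendre_values[of a "int p"] Legendre_values[of b "int p"] by auto
qed

lemma Jacobi_mult:
  assumes "odd n"
  shows "Jacobi (a * b) n = Jacobi a n * Jacobi b n"
proof -
  have "prime p" "odd p" if "p \<in># prime_factorization n" for p
    using that assms by (auto dest: in_prime_factors_imp_dvd intro: dvd_trans)
  thus ?thesis
    unfolding Jacobi_def prod.distrib[symmetric]
    by (intro prod.cong) (auto simp: Legendre_mult power_mult_distrib)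
qed

section \<open>Splitting the modulus into two factors\<close>

lemma add_mult_less_mult:
  fixes m :: nat
  assumes "r < m" "t < p"
  shows "r + m * t < m * p"
proof -
  have "r + m * t < m * Suc t" using assms by simp
  also have "\<dots> \<le> m * p" using assms by (intro mult_le_mono2) simp
  finally show ?thesis .
qed

text \<open>Mixed-radix arithmetic: the low digit is mapped modulo \<open>m\<close>, and its carry
  \<open>(a * int r + c) div int m\<close> becomes the offset for the high digit.\<close>

lemma affine_perm_split:
  assumes "r < m" "t < p"
  shows "affine_perm a c (m * p) (r + m * t)
    = affine_perm a c m r + m * affine_perm a ((a * int r + c) div int m) p t"
proof -
  define d where "d = a * int r + c"
  have lt: "r + m * t < m * p" using assms by (rule add_mult_less_mult)
  have "a * int (r + m * t) + c = d + int m * (a * int t)"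
    by (simp add: d_def algebra_simps)
  hence "int (affine_perm a c (m * p) (r + m * t)) = (d + int m * (a * int t)) mod (int m * int p)"
    using lt by (simp add: int_affine_perm)
  also have "\<dots> = int m * ((d + int m * (a * int t)) div int m mod int p)
      + (d + int m * (a * int t)) mod int m"
    by (simp add: zmod_zmult2_eq)
  also have "(d + int m * (a * int t)) div int m = a * int t + d div int m"
    using assms by simp
  also have "(d + int m * (a * int t)) mod int m = d mod int m" by simp
  also have "int m * ((a * int t + d div int m) mod int p) + d mod int m
      = int (affine_perm a c m r + m * affine_perm a (d div int m) p t)"
    using assms by (simp add: int_affine_perm d_def)
  finally show ?thesis by (simp only: of_nat_eq_iff d_def)
qed


text \<open>The skew product formula gives \<open>sign f ^ p * e ^ m\<close> with odd exponents. The
  offset in the fibre over \<open>r\<close> varies with \<open>r\<close>, hence the assumption that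
  the sign modulo \<open>p\<close> is the same for all offsets.\<close>

lemma sign_affine_perm_mult_modulus:
  assumes "coprime a (int (m * p))" "odd m" "odd p"
    and "\<And>d. sign (affine_perm a d p) = e"
  shows "sign (affine_perm a c (m * p)) = sign (affine_perm a c m) * e"
proof -
  define f where "f = affine_perm a c m"
  define g where "g r = affine_perm a ((a * int r + c) div int m) p" for r
  define h where "h = (\<lambda>(r, t). if r \<in> {0..<m} \<and> t \<in> {0..<p} then (f r, g r t) else (r, t))"
  define enc where "enc = (\<lambda>(r, t). r + m * t)"
  let ?S = "{0..<m} \<times> {0..<p}"
  have pos: "m > 0" "p > 0" using assms by (auto intro: Nat.gr0I)
  have f: "f permutes {0..<m}" and g: "\<And>r. g r permutes {0..<p}"
    using assms by (simp_all add: f_def g_def affine_perm_permutes)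
  have h: "h permutes ?S" "sign h = sign f ^ p * (\<Prod>r<m. sign (g r))"
    using sign_skew_product[of "{0..<m}" "{0..<p}" f g h] f g
    by (simp_all add: h_def atLeast0LessThan)
  have enc_lt: "enc (r, t) < m * p" if "r < m" "t < p" for r t
    using add_mult_less_mult[OF that] by (simp add: enc_def)
  have dec: "enc (r, t) mod m = r" "enc (r, t) div m = t" if "r < m" for r t
    using that by (simp_all add: enc_def)
  have enc: "bij_betw enc ?S {0..<m * p}"
  proof (rule bij_betwI[where g = "\<lambda>x. (x mod m, x div m)"])
    show "(\<lambda>x. (x mod m, x div m)) \<in> {0..<m * p} \<rightarrow> ?S"
      using pos by (auto simp: less_mult_imp_div_less mult.commute)
    show "enc \<in> ?S \<rightarrow> {0..<m * p}" using enc_lt by auto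
    show "(enc x mod m, enc x div m) = x" if "x \<in> ?S" for x
      using that dec by (cases x) auto
    show "enc (x mod m, x div m) = x" for x by (simp add: enc_def)
  qed
  have "affine_perm a c (m * p) = map_permutation ?S enc h"
  proof
    fix x
    show "affine_perm a c (m * p) x = map_permutation ?S enc h x"
    proof (cases "x < m * p")
      case True
      then obtain r t where rt: "r < m" "t < p" "x = enc (r, t)"
        by (intro that[of "x mod m" "x div m"])
           (use pos in \<open>simp_all add: enc_def less_mult_imp_div_less mult.commute\<close>)
      have "map_permutation ?S enc h x = enc (h (r, t))"
        unfolding rt(3) by (rule map_permutation_apply) (use enc rt in \<open>auto simp: bij_betw_def\<close>)
      also have "\<dots> = affine_perm a c (m * p) x"
        using rt by (simp add: h_def enc_def f_def g_def affine_perm_split)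
      finally show ?thesis by simp
    next
      case False
      hence "x \<notin> enc ` ?S" using bij_betw_imp_surj_on[OF enc] by simp
      thus ?thesis using False by (simp add: affine_perm_def map_permutation_def)
    qed
  qed
  hence "sign (affine_perm a c (m * p)) = sign h"
    using sign_map_permutation[of enc ?S h] enc h by (simp add: bij_betw_def)
  also have "\<dots> = sign f ^ p * e ^ m"
    using h(2) assms(4) by (simp add: g_def)
  also have "sign f ^ p = sign f"
    using assms by (cases f rule: sign_cases) auto
  \<comment> \<open>Offset 0 shows that \<open>e\<close> is itself a sign.\<close>
  also have "e ^ m = e"
    using assms by (cases "affine_perm a 0 p" rule: sign_cases) auto
  finally show ?thesis by (simp add: f_def)
qed

text \<open>The Zolotarev--Frobenius--Lerch theorem.\<close>

theorem sign_affine_perm: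
  assumes "odd n" "coprime a (int n)"
  shows "sign (affine_perm a c n) = Jacobi a n"
  using assms
proof (induction n arbitrary: c rule: less_induct)
  case (less n)
  have "n > 0" using less.prems by (auto intro: Nat.gr0I)
  show ?case
  proof (cases "n = 1")
    case True
    have "affine_perm a c 1 = id" by (auto simp: affine_perm_def fun_eq_iff)
    thus ?thesis unfolding True by (simp only: Jacobi_1 sign_id)
  next
    case False
    then obtain p where p: "prime p" "p dvd n" using prime_factor_nat by blast
    then obtain m where n: "n = m * p" by (auto simp: mult.commute elim: dvdE)
    have m: "m < n" "m > 0" using n \<open>n > 0\<close> prime_gt_1_nat[OF p(1)] by auto
    have "sign (affine_perm a c n) = sign (affine_perm a c m) * Legendre a (int p)"
      unfolding n by (rule sign_affine_perm_mult_modulus)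
        (use less.prems n p in \<open>auto intro!: sign_affine_perm_prime\<close>)
    also have "\<dots> = Jacobi a n"
      using less.IH[OF m(1)] less.prems m p n by (simp add: Jacobi_mult_prime)
    finally show ?thesis .
  qed
qed

section \<open>Determinants\<close>

text \<open>Sylvester's identity: the block matrix with identity diagonal blocks and off-diagonal
  blocks \<open>R\<close> and \<open>C\<close> factors both as \<open>L * U\<close> and as
  \<open>V * L\<close>, where \<open>det L = 1\<close>.\<close>

lemma det_one_minus_mult_commute:
  fixes R C :: "'a :: idom mat"
  assumes R: "R \<in> carrier_mat m n" and C: "C \<in> carrier_mat n m"
  shows "det (1\<^sub>m n - C * R) = det (1\<^sub>m m - R * C)"
proof -
  define L where "L = four_block_mat (1\<^sub>m m) (0\<^sub>m m n) C (1\<^sub>m n)"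
  define U where "U = four_block_mat (1\<^sub>m m) R (0\<^sub>m n m) (1\<^sub>m n - C * R)"
  define V where "V = four_block_mat (1\<^sub>m m - R * C) R (0\<^sub>m n m) (1\<^sub>m n)"
  have CR: "C * R \<in> carrier_mat n n" and RC: "R * C \<in> carrier_mat m m"
    using R C by auto
  have car: "L \<in> carrier_mat (m + n) (m + n)" "U \<in> carrier_mat (m + n) (m + n)"
    "V \<in> carrier_mat (m + n) (m + n)"
    unfolding L_def U_def V_def using CR RC by (auto intro!: four_block_carrier_mat minus_carrier_mat)
  have "L * U = four_block_mat (1\<^sub>m m) R C (1\<^sub>m n)"
    unfolding L_def U_def
    by (subst mult_four_block_mat[of _ m m _ n _ n _ _ m _ n])
       (use R C CR in \<open>auto intro!: cong_four_block_mat eq_matI\<close>)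
  moreover have "V * L = four_block_mat (1\<^sub>m m) R C (1\<^sub>m n)"
    unfolding L_def V_def
    by (subst mult_four_block_mat[of _ m m _ n _ n _ _ m _ n])
       (use R C RC in \<open>auto intro!: cong_four_block_mat eq_matI\<close>)
  ultimately have "det L * det U = det V * det L"
    using det_mult[OF car(1,2)] det_mult[OF car(3,1)] by simp
  moreover have "det L = 1"
    unfolding L_def det_four_block_mat_upper_right_zero[OF one_carrier_mat refl C one_carrier_mat]
    by simp
  moreover have "det U = det (1\<^sub>m n - C * R)"
    unfolding U_def det_four_block_mat_lower_left_zero[OF one_carrier_mat R refl minus_carrier_mat[OF CR]]
    by simp
  moreover have "det V = det (1\<^sub>m m - R * C)"
    unfolding V_def det_four_block_mat_lower_left_zero[OF minus_carrier_mat[OF RC] R refl one_carrier_mat]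
    by simp
  ultimately show ?thesis by simp
qed

text \<open>Matrix determinant lemma: for the column \<open>C\<close> of the \<open>w i\<close> and
  the row \<open>R\<close> of ones, \<open>X * (C * R)\<close> is the all-ones matrix. So the matrix
  is the negative of \<open>X * (1 - C * R)\<close>, and Sylvester's identity makes the second
  factor a determinant of size one.\<close>

lemma det_ones_minus:
  fixes X :: "'a :: idom mat"
  assumes X: "X \<in> carrier_mat n n"
    and w: "\<And>i. i < n \<Longrightarrow> (\<Sum>k<n. X $$ (i, k) * w k) = 1"
  shows "det (mat n n (\<lambda>(i, j). 1 - X $$ (i, j))) = (- 1) ^ n * det X * (1 - (\<Sum>k<n. w k))"
proof -
  define C where "C = mat n 1 (\<lambda>(i, _). w i)"
  define R :: "'a mat" where "R = mat 1 n (\<lambda>_. 1)"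
  have C: "C \<in> carrier_mat n 1" and R: "R \<in> carrier_mat 1 n" by (simp_all add: C_def R_def)
  have "X * (C * R) = mat n n (\<lambda>_. 1)"
    using X w by (intro eq_matI)
      (auto simp: C_def R_def scalar_prod_def atLeast0LessThan)
  hence "X * (1\<^sub>m n - C * R) = X - mat n n (\<lambda>_. 1)"
    using X C R by (simp add: mult_minus_distrib_mat[of X n n "1\<^sub>m n" n "C * R"])
  hence "mat n n (\<lambda>(i, j). 1 - X $$ (i, j)) = (- 1) \<cdot>\<^sub>m (X * (1\<^sub>m n - C * R))"
    using X by (intro eq_matI) auto
  moreover have "det (X * (1\<^sub>m n - C * R)) = det X * det (1\<^sub>m n - C * R)"
    using X C R by (intro det_mult[of _ n]) auto
  moreover have "det (1\<^sub>m n - C * R) = det (1\<^sub>m 1 - R * C)"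
    by (rule det_one_minus_mult_commute[OF R C])
  moreover have "det (1\<^sub>m 1 - R * C) = 1 - (\<Sum>k<n. w k)"
    by (subst det_single) (auto simp: C_def R_def scalar_prod_def atLeast0LessThan)
  ultimately show ?thesis
    using C R by (simp add: mult.assoc)
qed

text \<open>Left multiplication by \<open>L\<close> subtracts from each row its predecessor. Row 0
  stays, and every other row keeps only \<open>1 - z\<close> on the diagonal.\<close>

lemma det_two_valued_triangular:
  fixes z :: "'a :: idom"
  assumes "n > 0"
  shows "det (mat n n (\<lambda>(x, y). if y \<le> x then 1 else z)) = (1 - z) ^ (n - 1)"
proof -
  let ?T = "mat n n (\<lambda>(x, y). if y \<le> x then 1 else z)"
  define L :: "'a mat"
    where "L = mat n n (\<lambda>(x, y). if y = x then 1 else if Suc y = x then - 1 else 0)"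
  define U :: "'a mat"
    where "U = mat n n (\<lambda>(x, y). if x = 0 then if y = 0 then 1 else z
                                 else if x = y then 1 - z else 0)"
  have car: "L \<in> carrier_mat n n" "?T \<in> carrier_mat n n" "U \<in> carrier_mat n n"
    by (simp_all add: L_def U_def)
  have "L * ?T = U"
  proof (rule eq_matI)
    fix x y assume "x < dim_row U" "y < dim_col U"
    hence xy: "x < n" "y < n" by (simp_all add: U_def)
    let ?t = "\<lambda>k. if y \<le> k then 1 else z"
    have "(L * ?T) $$ (x, y) = (\<Sum>k<n. L $$ (x, k) * ?t k)"
      using xy by (simp add: L_def scalar_prod_def atLeast0LessThan)
    also have "\<dots> = (\<Sum>k<n. (if k = x then ?t k else 0) + (if Suc k = x then - ?t k else 0))"
      using xy by (intro sum.cong) (auto simp: L_def)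
    also have "\<dots> = ?t x + (\<Sum>k<n. if Suc k = x then - ?t k else 0)"
      using xy by (simp add: sum.distrib)
    also have "(\<Sum>k<n. if Suc k = x then - ?t k else 0) = (if x = 0 then 0 else - ?t (x - 1))"
    proof (cases x)
      case (Suc x')
      have "(\<Sum>k<n. if Suc k = x then - ?t k else 0) = (\<Sum>k<n. if k = x' then - ?t k else 0)"
        by (intro sum.cong) (auto simp: Suc)
      thus ?thesis using xy Suc by simp
    qed simp
    finally show "(L * ?T) $$ (x, y) = U $$ (x, y)"
      using xy by (auto simp: U_def)
  qed (simp_all add: L_def U_def)
  hence "det L * det ?T = det U" using det_mult[OF car(1,2)] by simp
  moreover have "det L = 1"
    by (subst det_lower_triangular[OF _ car(1)]) (auto simp: L_def prod_list_diag_prod)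
  moreover have "det U = (\<Prod>x<n. if x = 0 then 1 else 1 - z)"
    by (subst det_upper_triangular[OF _ car(3)])
       (auto simp: U_def prod_list_diag_prod atLeast0LessThan intro!: prod.cong)
  moreover have "(\<Prod>x<n. if x = 0 then 1 else 1 - z) = (1 - z) ^ (n - 1)"
    using assms by (cases n) (simp_all add: prod.lessThan_Suc_shift del: prod.lessThan_Suc)
  ultimately show ?thesis by simp
qed

lemma det_permute_scale:
  fixes f :: "nat \<Rightarrow> nat \<Rightarrow> 'a :: comm_ring_1"
  assumes \<sigma>: "\<sigma> permutes {0..<n}" and \<tau>: "\<tau> permutes {0..<n}"
  shows "det (mat n n (\<lambda>(i, j). \<alpha> i * \<beta> j * f (\<sigma> i) (\<tau> j)))
    = (\<Prod>i<n. \<alpha> i) * (\<Prod>j<n. \<beta> j) * of_int (sign \<sigma> * sign \<tau>) * det (mat n n (\<lambda>(i, j). f i j))"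
proof -
  have diag: "det (mat_diag n c) = (\<Prod>i<n. c i)" for c :: "nat \<Rightarrow> 'a"
    by (subst det_upper_triangular[of _ n])
       (auto simp: mat_diag_def prod_list_diag_prod atLeast0LessThan intro!: prod.cong)
  define A where "A = mat n n (\<lambda>(i, j). f i j)"
  \<comment> \<open>Stored transposed, so that permuting columns by \<open>\<tau>\<close> becomes a
    row permutation of the transpose of \<open>A\<close>.\<close>
  define B where "B = mat n n (\<lambda>(j, i). f i (\<tau> j))"
  define D where "D = mat n n (\<lambda>(i, j). f (\<sigma> i) (\<tau> j))"
  have less: "\<sigma> i < n" "\<tau> i < n" if "i < n" for i
    using that permutes_in_image[OF \<sigma>, of i] permutes_in_image[OF \<tau>, of i] by auto
  have car: "A \<in> carrier_mat n n" "B \<in> carrier_mat n n" "D \<in> carrier_mat n n"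
    by (simp_all add: A_def B_def D_def)
  have "B = mat n n (\<lambda>(i, j). A\<^sup>T $$ (\<tau> i, j))"
    using less by (intro eq_matI) (auto simp: A_def B_def)
  hence "det B = of_int (sign \<tau>) * det A"
    using det_permute_rows[of "A\<^sup>T" n \<tau>] \<tau> car(1) by (simp add: det_transpose)
  moreover have "D = mat n n (\<lambda>(i, j). B\<^sup>T $$ (\<sigma> i, j))"
    using less by (intro eq_matI) (auto simp: B_def D_def)
  hence "det D = of_int (sign \<sigma>) * det B"
    using det_permute_rows[of "B\<^sup>T" n \<sigma>] \<sigma> car(2) by (simp add: det_transpose)
  moreover have "mat n n (\<lambda>(i, j). \<alpha> i * \<beta> j * f (\<sigma> i) (\<tau> j)) = mat_diag n \<alpha> * (D * mat_diag n \<beta>)"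
    by (subst mat_diag_mult_right[OF car(3)], subst mat_diag_mult_left[of _ n n])
       (auto simp: D_def algebra_simps intro!: eq_matI)
  moreover have "det (mat_diag n \<alpha> * (D * mat_diag n \<beta>))
      = det (mat_diag n \<alpha>) * (det D * det (mat_diag n \<beta>))"
    using car by (simp add: det_mult[of _ n])
  ultimately show ?thesis by (simp add: diag A_def algebra_simps)
qed

text \<open>The three columns lie in the span of two vectors, the all-ones vector and
  \<open>v\<close>, and are therefore dependent.\<close>

lemma det_eq_0_of_three_affine_cols:
  fixes A :: "'a :: field mat"
  assumes A: "A \<in> carrier_mat n n"
    and ks: "k1 < n" "k2 < n" "k3 < n" "k1 \<noteq> k2" "k1 \<noteq> k3" "k2 \<noteq> k3"
    and col: "\<And>i k. i < n \<Longrightarrow> k \<in> {k1, k2, k3} \<Longrightarrow> A $$ (i, k) = c - v i * \<alpha> k"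
  shows "det A = 0"
proof -
  obtain c1 c2 c3 :: 'a where c: "c1 \<noteq> 0 \<or> c2 \<noteq> 0 \<or> c3 \<noteq> 0" "c1 + c2 + c3 = 0"
    "\<alpha> k1 * c1 + \<alpha> k2 * c2 + \<alpha> k3 * c3 = 0"
  proof (cases "\<alpha> k1 = \<alpha> k2")
    case True
    thus ?thesis using that[of 1 "-1" 0] by simp
  next
    case False
    show ?thesis
      \<comment> \<open>Up to sign, the cross product of \<open>(1, 1, 1)\<close> with the three
        values of \<open>\<alpha>\<close>; its last entry is nonzero in this case.\<close>
      by (rule that[of "\<alpha> k2 - \<alpha> k3" "\<alpha> k3 - \<alpha> k1" "\<alpha> k1 - \<alpha> k2"])
         (use False in \<open>auto simp: algebra_simps\<close>)
  qed
  define x where "x = vec n (\<lambda>k. if k = k1 then c1 else if k = k2 then c2 else if k = k3 then c3 else 0)"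
  have x: "x \<in> carrier_vec n" by (simp add: x_def)
  have xk: "x $ k1 = c1" "x $ k2 = c2" "x $ k3 = c3" using ks by (simp_all add: x_def)
  have "x \<noteq> 0\<^sub>v n" using c(1) ks xk by auto
  moreover have "A *\<^sub>v x = 0\<^sub>v n"
  proof (rule eq_vecI)
    fix i assume i: "i < dim_vec (0\<^sub>v n)"
    have "(A *\<^sub>v x) $ i = (\<Sum>k<n. A $$ (i, k) * x $ k)"
      using A i x by (simp add: scalar_prod_def atLeast0LessThan)
    also have "\<dots> = (\<Sum>k\<in>{k1, k2, k3}. A $$ (i, k) * x $ k)"
      using ks by (intro sum.mono_neutral_right) (auto simp: x_def)
    also have "\<dots> = c * (c1 + c2 + c3) - v i * (\<alpha> k1 * c1 + \<alpha> k2 * c2 + \<alpha> k3 * c3)"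
      using ks i by (simp add: xk col) (simp add: algebra_simps)
    also have "\<dots> = 0" unfolding c by simp
    finally show "(A *\<^sub>v x) $ i = 0\<^sub>v n $ i" using i by simp
  qed (use A in auto)
  ultimately show ?thesis using det_0_iff_vec_prod_zero_field[OF A] x by blast
qed

section \<open>The floor matrix\<close>

text \<open>The correction is the borrow in subtracting remainders; it is the source of the
  two-valued factor \<open>T\<close>.\<close>

lemma div_diff_eq_diff_div:
  fixes u w :: int
  assumes "n > 0"
  shows "(u - w) div n = u div n - w div n - (if u mod n < w mod n then 1 else 0)"
proof (rule int_div_pos_eq)
  let ?e = "if u mod n < w mod n then 1 else 0"
  have "n * (u div n - w div n - ?e) = (n * (u div n)) - (n * (w div n)) - n * ?e"
    by (simp add: right_diff_distrib)
  thus "u - w = n * (u div n - w div n - ?e) + (u mod n - w mod n + n * ?e)"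
    using mult_div_mod_eq[of n u] mult_div_mod_eq[of n w] by linarith
  show "0 \<le> u mod n - w mod n + n * ?e" "u mod n - w mod n + n * ?e < n"
    using assms pos_mod_bound[of n u] pos_mod_bound[of n w] pos_mod_sign[of n u] pos_mod_sign[of n w]
    by (auto simp del: pos_mod_bound pos_mod_sign)
qed

text \<open>The shifts by 1 translate zero-based indices. An independent \<open>b\<close> makes the
  family closed under transposition.\<close>

definition qfloor_mat :: "complex \<Rightarrow> nat \<Rightarrow> int \<Rightarrow> int \<Rightarrow> complex mat" where
  "qfloor_mat q n a b
    = mat n n (\<lambda>(j, k). qint q ((a * (int j + 1) - b * (int k + 1)) div int n))"

section \<open>Vanishing in the non-coprime case\<close>

text \<open>With \<open>d\<close> the gcd and \<open>m = n / d\<close>, moving \<open>m\<close>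
  columns to the right lowers the floor by exactly \<open>c = b / d\<close>. Columns 0,
  \<open>m\<close> and \<open>2 * m\<close> thus differ only in a scalar on the
  \<open>q\<close>-power part.\<close>

lemma det_qfloor_mat_eq_0_right:
  assumes n: "odd n" and q: "q \<noteq> 0" and b: "\<not> coprime b (int n)"
  shows "det (qfloor_mat q n a b) = 0"
proof -
  define d where "d = nat (gcd b (int n))"
  have "n > 0" using n by (auto intro: Nat.gr0I)
  have d: "int d = gcd b (int n)" by (simp add: d_def)
  hence "d \<noteq> 1" using b by (auto simp: coprime_iff_gcd_eq_1)
  have "int d dvd int n" "int d dvd b" by (simp_all add: d)
  then obtain m c where m: "n = d * m" and c: "b = int d * c"
    by (metis dvdE int_dvd_int_iff)
  \<comment> \<open>A divisor of an odd number other than 1 is at least 3, which leaves room for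
    three columns.\<close>
  have "d \<noteq> 0" "d \<noteq> 2" "m > 0" using m n \<open>n > 0\<close> by auto
  hence "d \<ge> 3" using \<open>d \<noteq> 1\<close> by auto
  hence "3 * m \<le> n" using m by simp
  define E where "E j = (a * (int j + 1) - b) div int n" for j
  have shift: "(a * (int j + 1) - b * (int (s * m) + 1)) div int n = E j - int s * c" for j s
  proof -
    have "a * (int j + 1) - b * (int (s * m) + 1) = (a * (int j + 1) - b) + (- int s * c) * int n"
      by (simp add: m c algebra_simps)
    moreover have "((a * (int j + 1) - b) + (- int s * c) * int n) div int n = - int s * c + E j"
      unfolding E_def using \<open>n > 0\<close> by (intro div_mult_self1) simp
    ultimately show ?thesis by (simp only:)
  qed
  show ?thesis
  proof (rule det_eq_0_of_three_affine_cols[where ?k1.0 = "0 * m" and ?k2.0 = "1 * m"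
        and ?k3.0 = "2 * m" and c = "1 / (1 - q)" and v = "\<lambda>j. q powi E j / (1 - q)"
        and \<alpha> = "\<lambda>k. q powi (- int (k div m) * c)"])
    show "qfloor_mat q n a b \<in> carrier_mat n n" by (simp add: qfloor_mat_def)
    fix j k assume "j < n" "k \<in> {0 * m, 1 * m, 2 * m}"
    then obtain s where s: "k = s * m" "s \<le> 2" by (metis insertE singletonD zero_le_numeral
          one_le_numeral order_refl)
    hence "s * m \<le> 2 * m" by simp
    hence "k < n" using \<open>3 * m \<le> n\<close> \<open>m > 0\<close> s by linarith
    have "qfloor_mat q n a b $$ (j, k) = qint q (E j - int s * c)"
      using \<open>j < n\<close> \<open>k < n\<close> shift[of j s] by (simp add: qfloor_mat_def s)
    also have "\<dots> = 1 / (1 - q) - q powi E j / (1 - q) * q powi (- int s * c)"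
      using q power_int_add[of q "E j" "- int s * c"] by (simp add: qint_def diff_divide_distrib)
    finally show "qfloor_mat q n a b $$ (j, k)
        = 1 / (1 - q) - q powi E j / (1 - q) * q powi (- int (k div m) * c)"
      using \<open>m > 0\<close> by (simp add: s)
  qed (use \<open>3 * m \<le> n\<close> \<open>m > 0\<close> in auto)
qed

lemma transpose_qfloor_mat: "(qfloor_mat q n a b)\<^sup>T = qfloor_mat q n (- b) (- a)"
  by (rule eq_matI) (auto simp: qfloor_mat_def algebra_simps)

lemma det_qfloor_mat_eq_0_left:
  assumes "odd n" "q \<noteq> 0" "\<not> coprime a (int n)"
  shows "det (qfloor_mat q n a b) = 0"
proof -
  have "det (qfloor_mat q n a b) = det (qfloor_mat q n (- b) (- a))"
    by (metis det_transpose transpose_qfloor_mat mat_carrier qfloor_mat_def)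
  thus ?thesis using assms by (simp add: det_qfloor_mat_eq_0_right)
qed

section \<open>The weight \<open>v\<close> and the triangular system it solves\<close>

text \<open>This puts any integer into the form on which \<open>v\<close> is prescribed;
  \<open>j\<close> ranges over \<open>1..n\<close> to match the matrix indices.\<close>

lemma ex_solution_mod:
  assumes "coprime a (int n)" "n > 0"
  obtains j A :: int where "1 \<le> j" "j \<le> int n" "x = a * j - int n * A"
proof -
  obtain y where y: "[a * y = 1] (mod int n)" using assms cong_solve_coprime_int by blast
  define j where "j = 1 + (y * x - 1) mod int n"
  have "0 \<le> (y * x - 1) mod int n" "(y * x - 1) mod int n < int n" using assms by simp_all
  hence j: "1 \<le> j" "j \<le> int n" unfolding j_def by linarith+
  have "[j = 1 + (y * x - 1)] (mod int n)" unfolding j_def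
    by (intro cong_add) simp_all
  hence "[a * j = a * (y * x)] (mod int n)" by (intro cong_mult) simp_all
  also have "a * (y * x) = (a * y) * x" by simp
  also have "[(a * y) * x = 1 * x] (mod int n)" by (intro cong_mult y) simp_all
  finally have "int n dvd a * j - x" by (simp add: cong_iff_dvd_diff)
  then obtain A where "a * j - x = int n * A" by (elim dvdE)
  thus ?thesis using that[of j A] j by simp
qed

text \<open>Coprimality makes \<open>x = a * j - n * A\<close> determine \<open>j\<close> in
  \<open>1..n\<close>, and then \<open>A\<close>, so the prescribed values never conflict.\<close>

lemma ex_residue_weight:
  fixes q :: complex
  assumes "coprime a (int n)"
  obtains v :: "int \<Rightarrow> complex" where
    "\<And>j A. 1 \<le> j \<Longrightarrow> j \<le> int n \<Longrightarrow> v (a * j - int n * A) = q powi (- A)"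
proof -
  define P where "P x A \<longleftrightarrow> (\<exists>j\<in>{1..int n}. x = a * j - int n * A)" for x A
  define v where "v x = q powi (- (THE A. P x A))" for x
  have "v (a * j - int n * A) = q powi (- A)" if j: "1 \<le> j" "j \<le> int n" for j A
  proof -
    have "(THE B. P (a * j - int n * A) B) = A"
    proof (rule the_equality)
      show "P (a * j - int n * A) A" using j by (auto simp: P_def)
    next
      fix B assume "P (a * j - int n * A) B"
      then obtain i where i: "1 \<le> i" "i \<le> int n" and eq: "a * j - int n * A = a * i - int n * B"
        by (auto simp: P_def)
      have "a * (j - i) = int n * (A - B)" using eq by (simp add: algebra_simps)
      hence "int n dvd a * (j - i)" by simp
      hence dvd: "int n dvd j - i"
        using assms by (simp add: coprime_commute coprime_dvd_mult_right_iff)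
      have "j - i = 0"
        using zdvd_not_zless[of "\<bar>j - i\<bar>" "int n"] dvd i j by fastforce
      thus "B = A" using eq j by simp
    qed
    thus ?thesis by (simp add: v_def)
  qed
  thus ?thesis by (rule that)
qed

lemma sum_backward_difference:
  fixes v :: "int \<Rightarrow> complex"
  shows "(\<Sum>y<n. v (int y) - v (int y - 1)) = v (int n - 1) - v (- 1)"
  by (induction n) (simp_all add: algebra_simps)

text \<open>The sum is \<open>z\<close> times the full telescoping sum plus \<open>1 - z\<close>
  times the one up to \<open>x\<close>; the condition on \<open>v (- 1)\<close> cancels the boundary
  terms.\<close>

lemma two_valued_triangular_solve:
  fixes v :: "int \<Rightarrow> complex"
  assumes "x < n" and v: "v (- 1) = z * v (int n - 1)"
  shows "(\<Sum>y<n. (if y \<le> x then 1 else z) * (v (int y) - v (int y - 1))) = (1 - z) * v (int x)"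
proof -
  let ?D = "\<lambda>y. v (int y) - v (int y - 1)"
  have "(\<Sum>y<n. (if y \<le> x then 1 else z) * ?D y)
      = (\<Sum>y<n. z * ?D y + (if y \<le> x then (1 - z) * ?D y else 0))"
    by (intro sum.cong) (auto simp: algebra_simps)
  also have "\<dots> = z * (\<Sum>y<n. ?D y) + (\<Sum>y<n. if y \<le> x then (1 - z) * ?D y else 0)"
    by (simp add: sum.distrib sum_distrib_left)
  also have "(\<Sum>y<n. if y \<le> x then (1 - z) * ?D y else 0) = (\<Sum>y<Suc x. (1 - z) * ?D y)"
    using assms by (intro sum.mono_neutral_cong_right) auto
  also have "\<dots> = (1 - z) * (\<Sum>y<Suc x. ?D y)"
    by (rule sum_distrib_left[symmetric])
  finally show ?thesis
    unfolding sum_backward_difference using v by (simp add: algebra_simps)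
qed


section \<open>The coprime case\<close>

text \<open>The exponent of \<open>q\<close> is \<open>-(n + 1) / 2\<close> from the quotients plus
  \<open>-(n - 1)\<close> from \<open>((1 - z) / (1 - q)) ^ (n - 1)\<close>.\<close>

lemma det_qfloor_mat_coprime:
  assumes n: "odd n" and q: "q \<noteq> 0" "q \<noteq> 1"
    and a: "coprime a (int n)" and b: "coprime (a + 1) (int n)"
  shows "det (qfloor_mat q n a (a + 1))
    = - of_int (Jacobi a n * Jacobi (a + 1) n) * q powi ((1 - 3 * int n) div 2)"
proof -
  have n0: "n > 0" using n by (auto intro: Nat.gr0I)
  define b where "b = a + 1"
  have b: "coprime b (int n)" using assms by (simp add: b_def)
  obtain v :: "int \<Rightarrow> complex"
    where v: "\<And>j A. 1 \<le> j \<Longrightarrow> j \<le> int n \<Longrightarrow> v (a * j - int n * A) = q powi (- A)"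
    using ex_residue_weight[OF a] by blast
  \<comment> \<open>Quasi-periodicity of \<open>v\<close>, extended from the prescribed form to
    every integer.\<close>
  have v_shift: "v (x - int n * B) = q powi (- B) * v x" for x B
  proof -
    obtain j A where j: "1 \<le> j" "j \<le> int n" and x: "x = a * j - int n * A"
      using ex_solution_mod[OF a n0] by blast
    have "x - int n * B = a * j - int n * (A + B)" by (simp add: x algebra_simps)
    hence "v (x - int n * B) = q powi (- (A + B))" using v j by simp
    also have "\<dots> = q powi (- B) * q powi (- A)" using q by (simp add: add.commute flip: power_int_add)
    finally show ?thesis using v[OF j] by (simp add: x)
  qed
  define z where "z = inverse q"
  have z1: "z \<noteq> 1" using q by (simp add: z_def)
  \<comment> \<open>The offset equals the multiplier because the zero-based \<open>j\<close> stands
    for the index \<open>j + 1\<close>.\<close>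
  define \<sigma> where "\<sigma> = affine_perm a a n"
  define \<tau> where "\<tau> = affine_perm b b n"
  have \<sigma>: "\<sigma> permutes {0..<n}" and \<tau>: "\<tau> permutes {0..<n}"
    using a b by (simp_all add: \<sigma>_def \<tau>_def affine_perm_permutes)
  define A where "A j = a * (int j + 1) div int n" for j
  define B where "B k = b * (int k + 1) div int n" for k
  have int_\<sigma>: "int (\<sigma> j) = a * (int j + 1) mod int n" and int_\<tau>: "int (\<tau> j) = b * (int j + 1) mod int n"
    if "j < n" for j
    using that by (simp_all add: \<sigma>_def \<tau>_def int_affine_perm algebra_simps)
  have \<sigma>A: "int (\<sigma> j) = a * (int j + 1) - int n * A j"
    and \<tau>B: "int (\<tau> j) = b * (int j + 1) - int n * B j" if "j < n" for j
    using int_\<sigma>[OF that] int_\<tau>[OF that] by (simp_all add: A_def B_def minus_mult_div_eq_mod)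
  define t where "t x y = (if y \<le> x then 1 else z)" for x y :: nat
  define X where "X = mat n n (\<lambda>(j, k). q powi A j * q powi (- B k) * t (\<sigma> j) (\<tau> k))"
  have X: "X \<in> carrier_mat n n" by (simp add: X_def)
  have X_entry: "X $$ (j, k) = q powi ((a * (int j + 1) - b * (int k + 1)) div int n)"
    if "j < n" "k < n" for j k
  proof -
    have "t (\<sigma> j) (\<tau> k) = q powi (- (if int (\<sigma> j) < int (\<tau> k) then 1 else 0))"
      by (auto simp: t_def z_def power_int_minus)
    hence "X $$ (j, k) = q powi (A j + - B k + - (if int (\<sigma> j) < int (\<tau> k) then 1 else 0))"
      using that q by (simp only: X_def index_mat split power_int_add simp_thms)
    thus ?thesis
      using n0 that by (simp add: div_diff_eq_diff_div int_\<sigma> int_\<tau> A_def B_def)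
  qed

  define w where "w k = (v (b * (int k + 1)) - v (b * (int k + 1) - 1)) / (1 - z)" for k
  have Xw: "(\<Sum>k<n. X $$ (j, k) * w k) = 1" if j: "j < n" for j
  proof -
    define D where "D y = v (int y) - v (int y - 1)" for y
    \<comment> \<open>After scaling, the summand depends on \<open>k\<close> only through
      \<open>\<tau> k\<close>, so the sum can be reindexed by \<open>\<tau>\<close>.\<close>
    have Bw: "q powi (- B k) * w k = D (\<tau> k) / (1 - z)" if "k < n" for k
    proof -
      have "v (int (\<tau> k)) = q powi (- B k) * v (b * (int k + 1))"
        using v_shift \<tau>B[OF that] by simp
      moreover have "int (\<tau> k) - 1 = (b * (int k + 1) - 1) - int n * B k" using \<tau>B[OF that] by simp
      hence "v (int (\<tau> k) - 1) = q powi (- B k) * v (b * (int k + 1) - 1)"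
        by (simp only: v_shift)
      ultimately show ?thesis by (simp add: D_def w_def algebra_simps)
    qed
    have "(\<Sum>k<n. X $$ (j, k) * w k) = (\<Sum>k<n. q powi A j / (1 - z) * (t (\<sigma> j) (\<tau> k) * D (\<tau> k)))"
    proof (rule sum.cong)
      fix k assume "k \<in> {..<n}"
      hence k: "k < n" by simp
      have "X $$ (j, k) * w k = q powi A j * t (\<sigma> j) (\<tau> k) * (q powi (- B k) * w k)"
        using j k by (simp add: X_def)
      also have "q powi (- B k) * w k = D (\<tau> k) / (1 - z)" by (rule Bw[OF k])
      finally show "X $$ (j, k) * w k = q powi A j / (1 - z) * (t (\<sigma> j) (\<tau> k) * D (\<tau> k))"
        by simp
    qed simp
    also have "\<dots> = q powi A j / (1 - z) * (\<Sum>k<n. t (\<sigma> j) (\<tau> k) * D (\<tau> k))"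
      by (rule sum_distrib_left[symmetric])
    also have "(\<Sum>k<n. t (\<sigma> j) (\<tau> k) * D (\<tau> k)) = (\<Sum>y<n. t (\<sigma> j) y * D y)"
      using sum.permute[OF \<tau>, of "\<lambda>y. t (\<sigma> j) y * D y"] by (simp add: atLeast0LessThan o_def)
    also have "\<dots> = (1 - z) * v (int (\<sigma> j))"
      unfolding t_def D_def
    proof (rule two_valued_triangular_solve)
      show "\<sigma> j < n" using j by (simp add: \<sigma>_def affine_perm_less)
      \<comment> \<open>The boundary condition is one period of quasi-periodicity.\<close>
      show "v (- 1) = z * v (int n - 1)"
        using v_shift[of "int n - 1" 1] by (simp add: z_def power_int_minus)
    qed
    also have "v (int (\<sigma> j)) = q powi (- A j)"
      unfolding \<sigma>A[OF j] by (rule v) (use j in auto)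
    also have "q powi A j / (1 - z) * ((1 - z) * q powi (- A j)) = 1"
      using z1 q by (simp add: power_int_minus)
    finally show ?thesis .
  qed

  have sum_w: "(\<Sum>k<n. w k) = q"
  proof -
    \<comment> \<open>Since \<open>b * (k + 1) - 1 = b * k + a\<close>, adding \<open>a\<close> only advances the index \<open>j\<close>, which
      leaves \<open>v\<close> unchanged unless \<open>j\<close> wraps around at \<open>n\<close>.\<close>
    have step: "v (b * int k + a) = v (b * int k)" if k: "0 < k" "k < n" for k
    proof -
      obtain j A where j: "1 \<le> j" "j \<le> int n" and x: "b * int k = a * j - int n * A"
        using ex_solution_mod[OF a n0] by blast
      have "j \<noteq> int n"
      proof
        assume "j = int n"
        hence "b * int k = int n * (a - A)" using x by (simp add: algebra_simps)
        hence "int n dvd b * int k" by simp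
        hence "int n dvd int k" using b by (simp add: coprime_commute coprime_dvd_mult_right_iff)
        thus False using k by (auto dest: zdvd_imp_le)
      qed
      hence "v (a * (j + 1) - int n * A) = q powi (- A)" using j by (intro v) auto
      moreover have "a * (j + 1) - int n * A = b * int k + a" using x by (simp add: algebra_simps)
      ultimately show ?thesis using v[OF j, of A] x by simp
    qed
    have "v a = 1" using v[of 1 0] n0 by simp
    \<comment> \<open>At \<open>k = 0\<close> the subtracted value is \<open>v a = 1\<close> instead
      of \<open>v 0\<close>, whence the correction.\<close>
    have summand: "v (b * (int k + 1)) - v (b * (int k + 1) - 1)
        = (v (b * int (Suc k)) - v (b * int k)) + (if k = 0 then v 0 - 1 else 0)" if "k < n" for k
    proof -
      have "b * (int k + 1) - 1 = b * int k + a" by (simp add: b_def algebra_simps)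
      thus ?thesis using step[of k] that \<open>v a = 1\<close> by (cases "k = 0") (simp_all add: algebra_simps)
    qed
    have "(\<Sum>k<n. v (b * (int k + 1)) - v (b * (int k + 1) - 1))
        = (\<Sum>k<n. (v (b * int (Suc k)) - v (b * int k)) + (if k = 0 then v 0 - 1 else 0))"
      by (intro sum.cong refl summand) simp
    also have "\<dots> = v (b * int n) - v 0 + (v 0 - 1)"
      using n0 sum_lessThan_telescope[of "\<lambda>k. v (b * int k)" n] by (simp only: sum.distrib) simp
    \<comment> \<open>Here \<open>j = n\<close> and \<open>A = -1\<close>, because
      \<open>b * n = a * n + n\<close>.\<close>
    also have "v (b * int n) = q"
    proof -
      have "b * int n = a * int n - int n * (- 1)" by (simp add: b_def algebra_simps)
      thus ?thesis using v[of "int n" "- 1"] n0 by simp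
    qed
    finally have "(\<Sum>k<n. w k) = (q - 1) / (1 - z)"
      by (simp add: w_def flip: sum_divide_distrib)
    also have "\<dots> = q" using q z1 by (simp add: z_def field_simps)
    finally show ?thesis .
  qed

  \<comment> \<open>The remainders of both families run over all residues and cancel in the sum;
    \<open>a - b = -1\<close> leaves only the sum of the indices.\<close>
  have sum_AB: "2 * (\<Sum>j<n. A j + - B j) = - (int n + 1)"
  proof -
    have "(\<Sum>j<n. int (\<sigma> j)) = (\<Sum>j<n. int j)" "(\<Sum>j<n. int (\<tau> j)) = (\<Sum>j<n. int j)"
      using sum.permute[OF \<sigma>, of int] sum.permute[OF \<tau>, of int]
      by (simp_all add: atLeast0LessThan o_def)
    moreover have "int n * (\<Sum>j<n. A j + - B j) = (\<Sum>j<n. int (\<tau> j) - int (\<sigma> j) - (int j + 1))"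
      unfolding sum_distrib_left
      by (intro sum.cong) (auto simp: \<sigma>A \<tau>B b_def algebra_simps)
    ultimately have "int n * (\<Sum>j<n. A j + - B j) = - (\<Sum>j<n. int j + 1)"
      by (simp add: sum_subtractf sum_negf)
    moreover have "2 * (\<Sum>j<n. int j + 1) = int n * (int n + 1)"
      by (induction n) (auto simp: algebra_simps)
    ultimately have "int n * (2 * (\<Sum>j<n. A j + - B j)) = int n * (- (int n + 1))"
      by (simp add: algebra_simps)
    thus ?thesis using n0 by simp
  qed

  have "(\<Prod>j<m. q powi A j) * (\<Prod>j<m. q powi (- B j)) = q powi (\<Sum>j<m. A j + - B j)" for m
    using q by (induction m) (simp_all add: power_int_add power_int_diff power_int_minus field_simps)
  hence detX: "det X = q powi (\<Sum>j<n. A j + - B j) * of_int (Jacobi a n * Jacobi b n) * (1 - z) ^ (n - 1)"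
    using n a b det_permute_scale[OF \<sigma> \<tau>, of "\<lambda>j. q powi A j" "\<lambda>k. q powi (- B k)" t]
      det_two_valued_triangular[OF n0, of z]
    by (simp add: X_def t_def \<sigma>_def \<tau>_def sign_affine_perm)
  obtain m where m: "n = 2 * m + 1" using n by (elim oddE)
  have S: "(\<Sum>j<n. A j + - B j) = - int m - 1" using sum_AB m by simp
  have "qfloor_mat q n a b = (1 / (1 - q)) \<cdot>\<^sub>m mat n n (\<lambda>(j, k). 1 - X $$ (j, k))"
    by (rule eq_matI) (auto simp: qfloor_mat_def qint_def X_entry)
  hence "det (qfloor_mat q n a b) = (1 / (1 - q)) ^ n * ((- 1) ^ n * det X * (1 - q))"
    using det_ones_minus[OF X Xw] by (simp add: sum_w)
  \<comment> \<open>The rank-one factor \<open>1 - q\<close> cancels one of the \<open>n\<close>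
    prefactors; odd \<open>n\<close> gives the sign.\<close>
  also have "\<dots> = - ((1 / (1 - q)) ^ (2 * m) * det X)"
    using q by (simp add: m)
  also have "\<dots> = - of_int (Jacobi a n * Jacobi b n)
      * (q powi (- int m - 1) * ((1 - z) / (1 - q)) ^ (2 * m))"
    unfolding detX S by (simp add: m power_divide)
  also have "(1 - z) / (1 - q) = - z" using q by (simp add: z_def field_simps)
  also have "q powi (- int m - 1) * (- z) ^ (2 * m) = q powi (- int m - 1 + - int (2 * m))"
  proof -
    have "(- z) ^ (2 * m) = q powi (- int (2 * m))"
      by (simp only: power_int_minus power_int_of_nat) (simp add: z_def power_inverse)
    thus ?thesis using q by (simp only: power_int_add simp_thms)
  qed
  also have "- int m - 1 + - int (2 * m) = (1 - 3 * int n) div 2" by (simp add: m)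
  finally show ?thesis by (simp add: b_def)
qed

theorem theorem1p1:
  fixes a :: int and n :: nat and q :: complex
  assumes "n > 0" and "odd n" and "q \<noteq> 0" and "q \<noteq> 1"
  shows "det (mat n n (\<lambda>(j, k).
            qint q \<lfloor>real_of_int (a * int (j + 1) - (a + 1) * int (k + 1)) / real n\<rfloor>))
         = - of_int (Jacobi (a * (a + 1)) n) * q powi ((1 - 3 * int n) div 2)"
proof -
  have "\<lfloor>real_of_int x / real n\<rfloor> = x div int n" for x
    using floor_divide_of_int_eq[of x "int n", where ?'a = real] by simp
  hence M: "mat n n (\<lambda>(j, k).
      qint q \<lfloor>real_of_int (a * int (j + 1) - (a + 1) * int (k + 1)) / real n\<rfloor>) = qfloor_mat q n a (a + 1)"
    by (simp only: qfloor_mat_def of_nat_add of_nat_1)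
  show ?thesis
  proof (cases "coprime a (int n) \<and> coprime (a + 1) (int n)")
    case True
    thus ?thesis unfolding M using assms by (simp add: det_qfloor_mat_coprime Jacobi_mult)
  next
    case False
    hence "det (qfloor_mat q n a (a + 1)) = 0"
      using assms det_qfloor_mat_eq_0_left det_qfloor_mat_eq_0_right by blast
    moreover have "Jacobi (a * (a + 1)) n = 0"
      using False assms by (intro Jacobi_eq_0) auto
    ultimately show ?thesis unfolding M by simp
  qed
qed

end
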